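(* Let $\epsilon>0$ be a fixed constant. Suppose a solution to a Sum-MR instance, in which all the clients are served indirectly, has sum of latencies $\ell$. Then it can be transformed to a solution in which all the clients are served perfectly and whose sum of latencies is at most $(3+\epsilon)\cdot\ell$.
   Context: A Sum-MR instance consists of a metric space $(V,d)$ with $d:V\times V\to\mathbb{Q}^+$; a set of repairmen $r_1,\dots,r_k$, where $r_i$ has start depot $s_i\in V$ and speed $v_i\in\mathbb{Q}^+$; and a set of clients $c_1,\dots,c_m$, where $c_j$ has start location $s'_j\in V$ and speed $v'_j\in\mathbb{Q}^+$. A solution assigns to each repairman $r_i$ a (not necessarily simple) path $p_i$ starting at $s_i$ together with a movement along it at speed at most $v_i$, and to each client $c_j$ a node $u_j$ and a time $t_j$ with $d(s'_j,u_j)\le v'_jt_j$ (so that $c_j$ can be at $u_j$ at time $t_j$). Client $c_j$ is served perfectly with latency $t_j$ if it is collocated with some repairman at $u_j$ at time $t_j$. Client $c_j$ is served indirectly with latency $t_j$ if some repairman visits $u_j$ at some time $t\le t_j$ and the client visits $u_j$ at time $t_j$. The sum of latencies is $\sum_j t_j$. Distances are scaled so that every client's service time (latency) is at least $1$. *)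

theory Defs
  imports "HOL-Analysis.Abstract_Metric_Spaces"
begin

(* Repairmen are indexed by {..<num_rep} and clients by {..<num_cli}; values of the
   function-valued fields outside these ranges are irrelevant. *)
record 'v sum_mr =
  points :: "'v set"
  dst :: "'v \<Rightarrow> 'v \<Rightarrow> real"
  num_rep :: nat
  depot :: "nat \<Rightarrow> 'v"
  rep_speed :: "nat \<Rightarrow> real"
  num_cli :: nat
  cli_start :: "nat \<Rightarrow> 'v"
  cli_speed :: "nat \<Rightarrow> real"

(* The rational numbers are kept inside type real so that the library's metric spaces
   apply. Speed 0 is allowed: the same set of (nonnegative) rationals serves as the range
   of the distances, which vanish on the diagonal. *)
definition sum_mr_instance :: "'v sum_mr \<Rightarrow> bool" where
  "sum_mr_instance I \<longleftrightarrow>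
     Metric_space (points I) (dst I) \<and>
     (\<forall>x\<in>points I. \<forall>y\<in>points I. dst I x y \<in> \<rat>) \<and>
     (\<forall>i<num_rep I. depot I i \<in> points I \<and> rep_speed I i \<in> \<rat> \<and> 0 \<le> rep_speed I i) \<and>
     (\<forall>j<num_cli I. cli_start I j \<in> points I \<and> cli_speed I j \<in> \<rat> \<and> 0 \<le> cli_speed I j)"

(* A path together with a movement along it: the traveller is at the node at position n of
   the path exactly during the closed time interval from arrival n to departure n, and
   is on the way to the next node in between. *)
record 'v route =
  nodes :: "'v list"
  arrival :: "nat \<Rightarrow> real"
  departure :: "nat \<Rightarrow> real"

definition valid_route :: "'v set \<Rightarrow> ('v \<Rightarrow> 'v \<Rightarrow> real) \<Rightarrow> 'v \<Rightarrow> real \<Rightarrow> 'v route \<Rightarrow> bool" where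
  "valid_route V d s v p \<longleftrightarrow>
     nodes p \<noteq> [] \<and> set (nodes p) \<subseteq> V \<and> hd (nodes p) = s \<and> arrival p 0 = 0 \<and>
     (\<forall>n<length (nodes p). arrival p n \<le> departure p n) \<and>
     (\<forall>n. Suc n < length (nodes p) \<longrightarrow>
        departure p n \<le> arrival p (Suc n) \<and>
        d (nodes p ! n) (nodes p ! Suc n) \<le> v * (arrival p (Suc n) - departure p n))"

definition located_at :: "'v route \<Rightarrow> 'v \<Rightarrow> real \<Rightarrow> bool" where
  "located_at p x t \<longleftrightarrow>
     (\<exists>n<length (nodes p). nodes p ! n = x \<and> arrival p n \<le> t \<and> t \<le> departure p n)"

record 'v solution =
  routes :: "nat \<Rightarrow> 'v route"
  serve_node :: "nat \<Rightarrow> 'v"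
  latency :: "nat \<Rightarrow> real"

definition sum_mr_solution :: "'v sum_mr \<Rightarrow> 'v solution \<Rightarrow> bool" where
  "sum_mr_solution I S \<longleftrightarrow>
     (\<forall>i<num_rep I. valid_route (points I) (dst I) (depot I i) (rep_speed I i) (routes S i)) \<and>
     (\<forall>j<num_cli I. serve_node S j \<in> points I \<and> 0 \<le> latency S j \<and>
        dst I (cli_start I j) (serve_node S j) \<le> cli_speed I j * latency S j)"

definition served_perfectly :: "'v sum_mr \<Rightarrow> 'v solution \<Rightarrow> nat \<Rightarrow> bool" where
  "served_perfectly I S j \<longleftrightarrow>
     (\<exists>i<num_rep I. located_at (routes S i) (serve_node S j) (latency S j))"

definition served_indirectly :: "'v sum_mr \<Rightarrow> 'v solution \<Rightarrow> nat \<Rightarrow> bool" where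
  "served_indirectly I S j \<longleftrightarrow>
     (\<exists>i<num_rep I. \<exists>t\<le>latency S j. located_at (routes S i) (serve_node S j) t)"

definition sum_latencies :: "'v sum_mr \<Rightarrow> 'v solution \<Rightarrow> real" where
  "sum_latencies I S = (\<Sum>j<num_cli I. latency S j)"

end

theory Submission
  imports Defs
begin

text \<open>
  Fix a repairman and let \<open>\<tau>\<^sub>i = c * 4 ^ i\<close>. From time \<open>\<tau>\<^sub>i\<close> on he repeats the part of his original
  movement up to time \<open>3/2 * \<tau>\<^sub>i\<close> and walks it back, which ends at the depot at time
  \<open>4 * \<tau>\<^sub>i = \<tau>\<^bsub>i+1\<^esub>\<close>. A client with latency \<open>t\<close> whose node was originally visited at time
  \<open>a \<le> t\<close> is met there at time \<open>\<tau>\<^sub>i + a\<close> as soon as \<open>\<tau>\<^sub>i \<ge> m := max (2/3 * a) (t - a)\<close>. Consider the two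
  schedules \<open>c = 1/4\<close> and \<open>c = 1/2\<close>: together their starting times are the powers of two from
  \<open>1/4\<close> on, so the first suitable ones in the two schedules are \<open>2 ^ k / 4\<close> and
  \<open>2 ^ (k + 1) / 4\<close> with \<open>2 ^ k / 4 \<le> 2 * m\<close>. The two new latencies of the client therefore
  average at most \<open>a + 3 * m \<le> 3 * t\<close>, and one of the two schedules has total at most
  three times the original one.
\<close>

section \<open>Movements as lists of timed visits\<close>

definition move :: "('v \<Rightarrow> 'v \<Rightarrow> real) \<Rightarrow> real \<Rightarrow> 'v \<times> real \<Rightarrow> 'v \<times> real \<Rightarrow> bool" where
  "move d v p q \<longleftrightarrow> snd p \<le> snd q \<and> d (fst p) (fst q) \<le> v * (snd q - snd p)"

text \<open>Arrivals suffice: a stay that serves a client indirectly begins no later than the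
  serving visit, so its arrival serves that client too.\<close>

definition visits :: "'v route \<Rightarrow> ('v \<times> real) list" where
  "visits p = map (\<lambda>n. (nodes p ! n, arrival p n)) [0..<length (nodes p)]"

text \<open>Stays have length zero; waiting is absorbed into slow travel, as \<open>move\<close>
  only bounds the speed from above.\<close>

definition route_of_visits :: "('v \<times> real) list \<Rightarrow> 'v route" where
  "route_of_visits ws =
     \<lparr>nodes = map fst ws, arrival = (\<lambda>n. snd (ws ! n)), departure = (\<lambda>n. snd (ws ! n))\<rparr>"

lemma visits_valid_route:
  assumes "valid_route V d s v p" and "0 \<le> v"
  shows "successively (move d v) (visits p)" "fst ` set (visits p) \<subseteq> V"
    "visits p \<noteq> []" "hd (visits p) = (s, 0)"
proof -
  have p: "nodes p \<noteq> []" "set (nodes p) \<subseteq> V" "hd (nodes p) = s" "arrival p 0 = 0"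
    "\<And>n. n < length (nodes p) \<Longrightarrow> arrival p n \<le> departure p n"
    "\<And>n. Suc n < length (nodes p) \<Longrightarrow> departure p n \<le> arrival p (Suc n) \<and>
        d (nodes p ! n) (nodes p ! Suc n) \<le> v * (arrival p (Suc n) - departure p n)"
    using assms(1) by (auto simp: valid_route_def)
  show "successively (move d v) (visits p)"
    unfolding successively_conv_nth
  proof (intro allI impI)
    fix n assume "Suc n < length (visits p)"
    hence n: "Suc n < length (nodes p)" by (simp add: visits_def)
    have "v * (arrival p (Suc n) - departure p n) \<le> v * (arrival p (Suc n) - arrival p n)"
      using p(5)[of n] n assms(2) by (intro mult_left_mono) auto
    then show "move d v (visits p ! n) (visits p ! Suc n)"
      using n p(5)[of n] p(6)[OF n] by (auto simp: move_def visits_def)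
  qed
  show "fst ` set (visits p) \<subseteq> V"
    using p(2) by (auto simp: visits_def)
  show "visits p \<noteq> []"
    using p(1) by (simp add: visits_def)
  then show "hd (visits p) = (s, 0)"
    using p(1,3,4) by (simp add: visits_def hd_map hd_conv_nth)
qed

lemma valid_route_of_visits:
  assumes "successively (move d v) ws" "fst ` set ws \<subseteq> V" "ws \<noteq> []" "hd ws = (s, 0)"
  shows "valid_route V d s v (route_of_visits ws)"
  using assms
  by (auto simp: valid_route_def route_of_visits_def successively_conv_nth move_def hd_map hd_conv_nth)

lemma located_at_route_of_visits:
  assumes "(y, t) \<in> set ws"
  shows "located_at (route_of_visits ws) y t"
proof -
  obtain n where "n < length ws" "ws ! n = (y, t)"
    using assms by (auto simp: in_set_conv_nth)
  then show ?thesis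
    by (auto simp: located_at_def route_of_visits_def intro!: exI[of _ n])
qed

section \<open>Sweeps out from the depot and back\<close>

lemma successively_move_hd_le:
  assumes "successively (move d v) (p # ps)" "q \<in> set ps"
  shows "snd p \<le> snd q"
  using assms
proof (induction ps arbitrary: p)
  case (Cons r ps)
  then show ?case by (fastforce simp: move_def)
qed simp

text \<open>Times never decrease along the list, so cutting at the first visit after
  \<open>x\<close> loses no earlier one.\<close>

lemma in_set_takeWhile_move:
  assumes "successively (move d v) ps" "q \<in> set ps" "snd q \<le> x"
  shows "q \<in> set (takeWhile (\<lambda>r. snd r \<le> x) ps)"
  using assms
proof (induction ps)
  case (Cons p ps)
  then have "snd p \<le> x"
    using successively_move_hd_le[OF Cons.prems(1), of q] by auto
  then show ?case using Cons by (auto simp: successively_Cons)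
qed simp

text \<open>The way out is the movement cut off at time \<open>x\<close> and delayed by \<tau>; the
  way back reflects its times at \<open>\<tau> + x\<close>, which is feasible by symmetry of
  \<open>d\<close>.\<close>

lemma ex_sweep:
  assumes "Metric_space V d" "0 \<le> v"
    and bs: "successively (move d v) bs" "fst ` set bs \<subseteq> V" "bs \<noteq> []" "hd bs = (s, 0)"
    and "0 \<le> x"
  obtains ws where "successively (move d v) ws" "fst ` set ws \<subseteq> V" "ws \<noteq> []"
    "hd ws = (s, \<tau>)" "last ws = (s, \<tau> + 2 * x)"
    "\<And>y a. (y, a) \<in> set bs \<Longrightarrow> a \<le> x \<Longrightarrow> (y, \<tau> + a) \<in> set ws"
proof -
  interpret Metric_space V d by fact
  define seg where "seg = takeWhile (\<lambda>r. snd r \<le> x) bs"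
  define out where "out = map (\<lambda>(y, a). (y, \<tau> + a)) seg"
  define return where "return = map (\<lambda>(y, a). (y, \<tau> + 2 * x - a)) (rev seg)"
  \<comment> \<open>As \<open>0 \<le> x\<close>, the cut keeps the first visit, so the way back ends
    at the depot.\<close>
  have seg_ne: "seg \<noteq> []" and hd_seg: "hd seg = (s, 0)"
    using bs(3,4) assms(7) by (cases bs; simp add: seg_def)+
  have "bs = seg @ dropWhile (\<lambda>r. snd r \<le> x) bs"
    by (simp add: seg_def)
  then have succ_seg: "successively (move d v) seg"
    using bs(1) by (metis successively_append_iff)
  have seg_V: "fst ` set seg \<subseteq> V"
    using bs(2) by (auto simp: seg_def dest!: set_takeWhileD)
  have succ_out: "successively (move d v) out"
    unfolding out_def successively_map
    by (rule successively_mono[OF succ_seg]) (auto simp: move_def)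
  have succ_return: "successively (move d v) return"
    unfolding return_def successively_map successively_rev
    by (rule successively_mono[OF succ_seg]) (auto simp: move_def commute)
  \<comment> \<open>The turning point is listed twice; between \<open>\<tau> + a\<close> and
    \<open>\<tau> + 2 * x - a\<close> the traveller waits there.\<close>
  have junction: "move d v (last out) (hd return)"
  proof -
    obtain y a where ya: "last seg = (y, a)" by fastforce
    with seg_ne have "(y, a) \<in> set seg" by (metis last_in_set)
    then have "y \<in> V" "a \<le> x"
      using seg_V by (force, auto simp: seg_def dest!: set_takeWhileD)
    then show ?thesis
      using seg_ne ya assms(2)
      by (simp add: out_def return_def last_map hd_map hd_rev move_def)
  qed
  show ?thesis
  proof (rule that[of "out @ return"])
    show "successively (move d v) (out @ return)"
      using succ_out succ_return junction by (simp add: successively_append_iff)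
    show "fst ` set (out @ return) \<subseteq> V"
      using seg_V by (force simp: out_def return_def)
    show "out @ return \<noteq> []" "hd (out @ return) = (s, \<tau>)" "last (out @ return) = (s, \<tau> + 2 * x)"
      using seg_ne hd_seg by (simp_all add: out_def return_def hd_map last_map last_rev)
    fix y a assume "(y, a) \<in> set bs" "a \<le> x"
    then have "(y, a) \<in> set seg"
      unfolding seg_def using in_set_takeWhile_move[OF bs(1)] by fastforce
    then show "(y, \<tau> + a) \<in> set (out @ return)"
      by (force simp: out_def)
  qed
qed

text \<open>Induction on the number \<open>K\<close> of sweeps. Tracking \<open>last ws\<close> lets
  the next sweep be appended, since it begins at the same node and time.\<close>

lemma ex_repeated_sweeps:
  assumes "Metric_space V d" "0 \<le> v"
    and bs: "successively (move d v) bs" "fst ` set bs \<subseteq> V" "bs \<noteq> []" "hd bs = (s, 0)"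
    and "0 \<le> c"
  shows "\<exists>ws. successively (move d v) ws \<and> fst ` set ws \<subseteq> V \<and> ws \<noteq> [] \<and>
    hd ws = (s, 0) \<and> last ws = (s, c * 4 ^ K) \<and>
    (\<forall>i<K. \<forall>(y, a)\<in>set bs. a \<le> 3/2 * (c * 4 ^ i) \<longrightarrow> (y, c * 4 ^ i + a) \<in> set ws)"
proof (induction K)
  interpret Metric_space V d by fact
  have [simp]: "d s s = 0"
    using bs(2-4) by (cases bs) auto
  case 0
  have "s \<in> V" using bs(2-4) by (cases bs) auto
  \<comment> \<open>Wait at the depot until the first sweep begins, at
    \<open>c * 4 ^ 0\<close>.\<close>
  then show ?case
    using assms(2,7) by (intro exI[of _ "[(s, 0), (s, c)]"]) (auto simp: move_def)
next
  interpret Metric_space V d by fact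
  have [simp]: "d s s = 0"
    using bs(2-4) by (cases bs) auto
  case (Suc K)
  then obtain ws where ws: "successively (move d v) ws" "fst ` set ws \<subseteq> V" "ws \<noteq> []"
    "hd ws = (s, 0)" "last ws = (s, c * 4 ^ K)"
    "\<forall>i<K. \<forall>(y, a)\<in>set bs. a \<le> 3/2 * (c * 4 ^ i) \<longrightarrow> (y, c * 4 ^ i + a) \<in> set ws"
    by blast
  define \<tau> where "\<tau> = c * 4 ^ K"
  have "0 \<le> 3/2 * \<tau>" using assms(7) by (simp add: \<tau>_def)
  from ex_sweep[OF assms(1,2) bs this, of \<tau>] obtain us where
    us: "successively (move d v) us" "fst ` set us \<subseteq> V" "us \<noteq> []"
    "hd us = (s, \<tau>)" "last us = (s, \<tau> + 2 * (3/2 * \<tau>))"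
    "\<And>y a. (y, a) \<in> set bs \<Longrightarrow> a \<le> 3/2 * \<tau> \<Longrightarrow> (y, \<tau> + a) \<in> set us"
    by blast
  show ?case
  proof (intro exI[of _ "ws @ us"] conjI)
    show "successively (move d v) (ws @ us)"
      using ws us by (simp add: successively_append_iff move_def \<tau>_def)
    show "\<forall>i<Suc K. \<forall>(y, a)\<in>set bs. a \<le> 3/2 * (c * 4 ^ i) \<longrightarrow> (y, c * 4 ^ i + a) \<in> set (ws @ us)"
      using ws(6) us(6) by (fastforce simp: \<tau>_def less_Suc_eq)
  qed (use ws us in \<open>auto simp: \<tau>_def\<close>)
qed

section \<open>The solution given by one schedule\<close>

text \<open>Client \<open>j\<close> meets repairman \<open>r j\<close> in sweep \<open>k j\<close>,
  at the node visited originally at time \<open>a j\<close>. It keeps its node and is there no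
  earlier than before, so its own speed bound still holds.\<close>

lemma ex_sweep_solution:
  assumes I: "sum_mr_instance I" and S: "sum_mr_solution I S" and "0 \<le> c"
    and r: "\<And>j. j < num_cli I \<Longrightarrow> r j < num_rep I \<and> (serve_node S j, a j) \<in> set (visits (routes S (r j)))"
    and k: "\<And>j. j < num_cli I \<Longrightarrow> a j \<le> 3/2 * (c * 4 ^ k j) \<and> latency S j \<le> c * 4 ^ k j + a j"
  shows "\<exists>S'. sum_mr_solution I S' \<and> (\<forall>j<num_cli I. served_perfectly I S' j) \<and>
    sum_latencies I S' = (\<Sum>j<num_cli I. c * 4 ^ k j + a j)"
proof -
  \<comment> \<open>Routes are finite lists, so one number of sweeps has to cover all clients; the
    sum bounds every \<open>k j\<close>.\<close>
  define K where "K = Suc (\<Sum>j<num_cli I. k j)"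
  have kK: "k j < K" if "j < num_cli I" for j
    using member_le_sum[of j "{..<num_cli I}" k] that by (simp add: K_def)
  have M: "Metric_space (points I) (dst I)"
    using I by (simp add: sum_mr_instance_def)
  define good where "good i ws \<longleftrightarrow>
      successively (move (dst I) (rep_speed I i)) ws \<and> fst ` set ws \<subseteq> points I \<and> ws \<noteq> [] \<and>
      hd ws = (depot I i, 0) \<and>
      (\<forall>n<K. \<forall>(y, b)\<in>set (visits (routes S i)). b \<le> 3/2 * (c * 4 ^ n) \<longrightarrow> (y, c * 4 ^ n + b) \<in> set ws)"
    for i ws
  have "\<exists>ws. good i ws" if "i < num_rep I" for i
  proof -
    have v: "0 \<le> rep_speed I i" using I that by (simp add: sum_mr_instance_def)
    have "valid_route (points I) (dst I) (depot I i) (rep_speed I i) (routes S i)"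
      using S that by (simp add: sum_mr_solution_def)
    from ex_repeated_sweeps[OF M v visits_valid_route[OF this v] assms(3), of K]
    show ?thesis unfolding good_def by blast
  qed
  then obtain W where W: "\<And>i. i < num_rep I \<Longrightarrow> good i (W i)"
    by metis
  define S' where "S' = \<lparr>routes = (\<lambda>i. route_of_visits (W i)), serve_node = serve_node S,
    latency = (\<lambda>j. c * 4 ^ k j + a j)\<rparr>"
  have "sum_mr_solution I S'"
    unfolding sum_mr_solution_def
  proof (intro conjI allI impI)
    fix i assume "i < num_rep I"
    then show "valid_route (points I) (dst I) (depot I i) (rep_speed I i) (routes S' i)"
      using W[of i] by (simp add: good_def S'_def valid_route_of_visits)
  next
    fix j assume j: "j < num_cli I"
    have old: "serve_node S j \<in> points I" "0 \<le> latency S j"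
      "dst I (cli_start I j) (serve_node S j) \<le> cli_speed I j * latency S j"
      using S j by (simp_all add: sum_mr_solution_def)
    have le: "latency S j \<le> latency S' j"
      using k[OF j] by (simp add: S'_def)
    show "serve_node S' j \<in> points I" using old by (simp add: S'_def)
    show "0 \<le> latency S' j" using old le by linarith
    have "cli_speed I j * latency S j \<le> cli_speed I j * latency S' j"
      using I j le by (intro mult_left_mono) (auto simp: sum_mr_instance_def)
    then show "dst I (cli_start I j) (serve_node S' j) \<le> cli_speed I j * latency S' j"
      using old by (simp add: S'_def)
  qed
  moreover have "served_perfectly I S' j" if j: "j < num_cli I" for j
  proof -
    have "(serve_node S j, c * 4 ^ k j + a j) \<in> set (W (r j))"
      using W[of "r j"] r[OF j] k[OF j] kK[OF j] unfolding good_def by blast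
    from located_at_route_of_visits[OF this] show ?thesis
      using r[OF j] by (auto simp: served_perfectly_def S'_def)
  qed
  moreover have "sum_latencies I S' = (\<Sum>j<num_cli I. c * 4 ^ k j + a j)"
    by (simp add: sum_latencies_def S'_def)
  ultimately show ?thesis by blast
qed

section \<open>Choice of the sweeps\<close>

lemma ex_powers_ge:
  fixes m :: real
  assumes "1/4 \<le> m"
  shows "\<exists>p q. m \<le> 1/4 * 4 ^ p \<and> m \<le> 1/2 * 4 ^ q \<and> 1/4 * 4 ^ p + 1/2 * 4 ^ q \<le> 6 * m"
proof -
  define k where "k = (LEAST k. m \<le> 2 ^ k / 4)"
  obtain n where "4 * m < 2 ^ n" using real_arch_pow[of 2 "4 * m"] by auto
  then have "m \<le> 2 ^ n / 4" by simp
  then have lo: "m \<le> 2 ^ k / 4" unfolding k_def by (rule LeastI)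
  \<comment> \<open>By minimality, half of \<open>2 ^ k / 4\<close> is below \<open>m\<close>; for
    \<open>k = 0\<close> the bound \<open>1/4 \<le> m\<close> takes over.\<close>
  have hi: "2 ^ k / 4 \<le> 2 * m"
  proof (cases k)
    case 0
    then show ?thesis using assms by simp
  next
    case (Suc l)
    then have "\<not> m \<le> 2 ^ l / 4" unfolding k_def by (metis lessI not_less_Least)
    then show ?thesis using Suc by simp
  qed
  show ?thesis
  proof (cases "even k")
    case True
    then obtain p where "k = 2 * p" by blast
    then have "(2::real) ^ k = 4 ^ p" by (simp add: power_mult)
    then show ?thesis using lo hi assms by (intro exI[of _ p]) auto
  next
    case False
    then obtain p where "k = 2 * p + 1" by (elim oddE)
    then have "(2::real) ^ k = 2 * 4 ^ p" by (simp add: power_mult)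
    \<comment> \<open>For odd \<open>k\<close> the least power belongs to the schedule
      \<open>c = 1/2\<close>, and its double to \<open>c = 1/4\<close> with the exponent one
      higher.\<close>
    then show ?thesis using lo hi by (intro exI[of _ "Suc p"] exI[of _ p]) auto
  qed
qed

lemma ex_sweep_times:
  fixes a t :: real
  assumes "0 \<le> a" "a \<le> t" "1 \<le> t"
  shows "\<exists>p q. (a \<le> 3/2 * (1/4 * 4 ^ p) \<and> t \<le> 1/4 * 4 ^ p + a) \<and>
    (a \<le> 3/2 * (1/2 * 4 ^ q) \<and> t \<le> 1/2 * 4 ^ q + a) \<and>
    (1/4 * 4 ^ p + a) + (1/2 * 4 ^ q + a) \<le> 6 * t"
proof -
  \<comment> \<open>The sweep reaches the visit if it starts at \<open>2/3 * a\<close> or later; the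
    client is at the node in time if it starts at \<open>t - a\<close> or later.\<close>
  define m where "m = max (2/3 * a) (t - a)"
  \<comment> \<open>In the two cases of the maximum, \<open>3 * m + a\<close> is
    \<open>3 * a\<close> or \<open>3 * t - 2 * a\<close>.\<close>
  have m: "2/3 * a \<le> m" "t - a \<le> m" "3 * m + a \<le> 3 * t"
    using assms by (auto simp: m_def max_def)
  \<comment> \<open>The first two bounds give \<open>t \<le> 5/2 * m\<close>, so
    \<open>1 \<le> t\<close> yields even \<open>2/5 \<le> m\<close>.\<close>
  then have "1/4 \<le> m" using assms by linarith
  from ex_powers_ge[OF this] obtain p q where
    "m \<le> 1/4 * 4 ^ p" "m \<le> 1/2 * 4 ^ q" "1/4 * 4 ^ p + 1/2 * 4 ^ q \<le> 6 * m"
    by blast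
  with m show ?thesis by (intro exI[of _ p] exI[of _ q] conjI) linarith+
qed

theorem lemma1:
  fixes \<epsilon> L :: real and I :: "'v sum_mr" and S :: "'v solution"
  assumes "\<epsilon> > 0"
    and "sum_mr_instance I"
    and "sum_mr_solution I S"
    and "\<forall>j<num_cli I. 1 \<le> latency S j"
    and "\<forall>j<num_cli I. served_indirectly I S j"
    and "sum_latencies I S = L"
  shows "\<exists>S'. sum_mr_solution I S' \<and>
              (\<forall>j<num_cli I. served_perfectly I S' j) \<and>
              sum_latencies I S' \<le> (3 + \<epsilon>) * L"
proof -
  \<comment> \<open>The witness \<open>a\<close> is the arrival that begins the serving stay; it is
    nonnegative because times start at 0 and never decrease.\<close>
  have "\<exists>i a. i < num_rep I \<and> (serve_node S j, a) \<in> set (visits (routes S i)) \<and>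
      0 \<le> a \<and> a \<le> latency S j" if j: "j < num_cli I" for j
  proof -
    obtain i t n where i: "i < num_rep I" "t \<le> latency S j" "n < length (nodes (routes S i))"
      "nodes (routes S i) ! n = serve_node S j" "arrival (routes S i) n \<le> t"
      using assms(5) j by (auto simp: served_indirectly_def located_at_def)
    define a where "a = arrival (routes S i) n"
    have in_visits: "(serve_node S j, a) \<in> set (visits (routes S i))"
      using i by (force simp: visits_def a_def)
    have v: "0 \<le> rep_speed I i"
      using assms(2) i(1) by (simp add: sum_mr_instance_def)
    have "valid_route (points I) (dst I) (depot I i) (rep_speed I i) (routes S i)"
      using assms(3) i(1) by (simp add: sum_mr_solution_def)
    note vis = visits_valid_route[OF this v]
    obtain ps where ps: "visits (routes S i) = (depot I i, 0) # ps"
      using vis(3,4) by (metis list.collapse)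
    have "0 \<le> a"
      using successively_move_hd_le[of "dst I" "rep_speed I i" "(depot I i, 0)" ps "(serve_node S j, a)"]
        vis(1) in_visits by (auto simp: ps)
    then show ?thesis
      using in_visits i by (intro exI[of _ i] exI[of _ a]) (auto simp: a_def)
  qed
  then obtain r a where ra: "\<And>j. j < num_cli I \<Longrightarrow> r j < num_rep I \<and>
      (serve_node S j, a j) \<in> set (visits (routes S (r j))) \<and> 0 \<le> a j \<and> a j \<le> latency S j"
    by metis
  have "\<exists>p q. (a j \<le> 3/2 * (1/4 * 4 ^ p) \<and> latency S j \<le> 1/4 * 4 ^ p + a j) \<and>
      (a j \<le> 3/2 * (1/2 * 4 ^ q) \<and> latency S j \<le> 1/2 * 4 ^ q + a j) \<and>
      (1/4 * 4 ^ p + a j) + (1/2 * 4 ^ q + a j) \<le> 6 * latency S j" if "j < num_cli I" for j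
    using ex_sweep_times ra[OF that] assms(4) that by blast
  then obtain p q where
    p: "\<And>j. j < num_cli I \<Longrightarrow> a j \<le> 3/2 * (1/4 * 4 ^ p j) \<and> latency S j \<le> 1/4 * 4 ^ p j + a j" and
    q: "\<And>j. j < num_cli I \<Longrightarrow> a j \<le> 3/2 * (1/2 * 4 ^ q j) \<and> latency S j \<le> 1/2 * 4 ^ q j + a j" and
    pq: "\<And>j. j < num_cli I \<Longrightarrow> (1/4 * 4 ^ p j + a j) + (1/2 * 4 ^ q j + a j) \<le> 6 * latency S j"
    by metis
  let ?P = "\<Sum>j<num_cli I. 1/4 * 4 ^ p j + a j"
  let ?Q = "\<Sum>j<num_cli I. 1/2 * 4 ^ q j + a j"
  \<comment> \<open>Only totals are compared: one schedule is chosen for all clients at once, and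
    the bound of three need not hold for each client.\<close>
  have "?P + ?Q \<le> (\<Sum>j<num_cli I. 6 * latency S j)"
    unfolding sum.distrib[symmetric] by (rule sum_mono) (use pq in simp)
  then have "?P + ?Q \<le> 6 * L"
    using assms(6) by (simp add: sum_latencies_def flip: sum_distrib_left)
  then have "?P \<le> 3 * L \<or> ?Q \<le> 3 * L" by linarith
  moreover have "3 * L \<le> (3 + \<epsilon>) * L"
  proof -
    have "0 \<le> L"
      using assms(3,6) by (auto simp: sum_latencies_def sum_mr_solution_def intro!: sum_nonneg)
    then show ?thesis using assms(1) by (intro mult_right_mono) auto
  qed
  ultimately have "?P \<le> (3 + \<epsilon>) * L \<or> ?Q \<le> (3 + \<epsilon>) * L" by linarith
  moreover have "\<exists>S'. sum_mr_solution I S' \<and> (\<forall>j<num_cli I. served_perfectly I S' j) \<and>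
      sum_latencies I S' = ?P"
    by (rule ex_sweep_solution[OF assms(2,3) _ _ p]) (use ra in auto)
  moreover have "\<exists>S'. sum_mr_solution I S' \<and> (\<forall>j<num_cli I. served_perfectly I S' j) \<and>
      sum_latencies I S' = ?Q"
    by (rule ex_sweep_solution[OF assms(2,3) _ _ q]) (use ra in auto)
  ultimately show ?thesis by metis
qed

end
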